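(* Let $\ell\ge3$. Suppose that $\lambda$ is an $(\ell,0)$-JM partition and $0\le i<\ell$. Write $\widehat\varphi=\widehat\varphi_i(\lambda)$ and $\widehat\varepsilon=\widehat\varepsilon_i(\lambda)$. Then 1. $\widehat f_i^{\,\widehat\varphi}\lambda$ is an $(\ell,0)$-JM partition; 2. $\widehat e_i^{\,\widehat\varepsilon}\lambda$ is an $(\ell,0)$-JM partition.
   Context: $h^\lambda_{(a,b)}$ is the hook length of the box in row $a$, column $b$: the number of boxes of $\lambda$ to the right of and below $(a,b)$ (same row or column), including $(a,b)$. A partition $\lambda$ is an $(\ell,0)$-JM partition if there do not exist boxes $(a,b),(a,y),(x,b)$ in its Young diagram with $\ell\mid h^\lambda_{(a,b)}$, $\ell\nmid h^\lambda_{(a,y)}$ and $\ell\nmid h^\lambda_{(x,b)}$. Ladder crystal operators. The position $(a,b)$ (row $a$, column $b$) has residue $b-a\bmod\ell$. The ladder of $(a,b)$ is the set of positions $(c,d)$, $c,d\ge1$, with $c-a=(\ell-1)(b-d)$; all its positions have the same residue, and it is an $i$-ladder if that residue is $i$. Ladders are ordered left to right, i.e. by increasing value of $a+(\ell-1)(b-1)$. A box of $\lambda$ of residue $i$ whose removal leaves a partition is a removable $i$-box; a position of residue $i$ not in $\lambda$ whose addition gives a partition is an addable $i$-box. Given a partition $\lambda$, label each addable $i$-box $+$ and each removable $i$-box $-$; the ladder $i$-signature is the word read from leftmost $i$-ladder to rightmost $i$-ladder, and from top to bottom on each ladder. Repeatedly cancel adjacent pairs $-+$ to get the reduced ladder $i$-signature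 $+\cdots+-\cdots-$. The number of remaining $+$'s is $\widehat\varphi_i(\lambda)$ and the number of remaining $-$'s is $\widehat\varepsilon_i(\lambda)$. $\widehat f_i\lambda$ is $\lambda$ together with the box of the rightmost remaining $+$ (or $0$ if there is none); $\widehat e_i\lambda$ is $\lambda$ with the box of the leftmost remaining $-$ removed (or $0$ if there is none). *)

theory Defs
  imports Main "HOL-Library.Product_Lexorder"
begin

text \<open>
  A partition is identified with its Young diagram, a finite set of boxes \<open>(a, b)\<close>
  (row \<open>a\<close>, column \<open>b\<close>, both counted from 1) that is closed under moving up and left.
\<close>

type_synonym box = "nat \<times> nat"

definition is_partition :: "box set \<Rightarrow> bool" where
  "is_partition lam \<longleftrightarrow> finite lam \<and> (\<forall>(a, b) \<in> lam. 1 \<le> a \<and> 1 \<le> b) \<and>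
     (\<forall>(a, b) \<in> lam. \<forall>c d. 1 \<le> c \<and> c \<le> a \<and> 1 \<le> d \<and> d \<le> b \<longrightarrow> (c, d) \<in> lam)"

definition hook_length :: "box set \<Rightarrow> nat \<Rightarrow> nat \<Rightarrow> nat" where
  "hook_length lam a b = card {(c, d) \<in> lam. (c = a \<and> b \<le> d) \<or> (d = b \<and> a \<le> c)}"

definition JM_partition :: "nat \<Rightarrow> box set \<Rightarrow> bool" where
  "JM_partition l lam \<longleftrightarrow> is_partition lam \<and>
     \<not> (\<exists>a b x y. (a, b) \<in> lam \<and> (a, y) \<in> lam \<and> (x, b) \<in> lam \<and>
          l dvd hook_length lam a b \<and> \<not> l dvd hook_length lam a y \<and> \<not> l dvd hook_length lam x b)"

definition residue :: "nat \<Rightarrow> box \<Rightarrow> int" where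
  "residue l = (\<lambda>(a, b). (int b - int a) mod int l)"

definition removable :: "nat \<Rightarrow> int \<Rightarrow> box set \<Rightarrow> box set" where
  "removable l i lam = {x \<in> lam. residue l x = i \<and> is_partition (lam - {x})}"

definition addable :: "nat \<Rightarrow> int \<Rightarrow> box set \<Rightarrow> box set" where
  "addable l i lam = {x. x \<notin> lam \<and> residue l x = i \<and> is_partition (insert x lam)}"

definition ladder_value :: "nat \<Rightarrow> box \<Rightarrow> int" where
  "ladder_value l = (\<lambda>(a, b). int a + (int l - 1) * (int b - 1))"

text \<open>Two positions lie on the same ladder iff they have the same \<^const>\<open>ladder_value\<close>.\<close>

lemma same_ladder_iff:
  "int c - int a = (int l - 1) * (int b - int d) \<longleftrightarrow> ladder_value l (c, d) = ladder_value l (a, b)"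
  by (auto simp: ladder_value_def algebra_simps)

lemma same_ladder_residue:
  assumes "ladder_value l (c, d) = ladder_value l (a, b)"
  shows "residue l (c, d) = residue l (a, b)"
proof -
  have "(int d - int c) - (int b - int a) = int l * (int d - int b)"
    using assms by (simp add: ladder_value_def algebra_simps)
  then have "int l dvd (int d - int c) - (int b - int a)"
    by simp
  then show ?thesis
    by (simp add: residue_def mod_eq_dvd_iff)
qed

text \<open>
  Reading order: by ladder from left to right, then by row. The order on pairs is lexicographic.
\<close>

definition reading_key :: "nat \<Rightarrow> box \<Rightarrow> int \<times> nat" where
  "reading_key l x = (ladder_value l x, fst x)"

datatype sign = Plus | Minus

text \<open>The letters of a signature remember the box they come from.\<close>

definition ladder_signature :: "nat \<Rightarrow> int \<Rightarrow> box set \<Rightarrow> (sign \<times> box) list" where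
  "ladder_signature l i lam =
     map (\<lambda>x. (if x \<in> addable l i lam then Plus else Minus, x))
       (sorted_key_list_of_set (reading_key l) (addable l i lam \<union> removable l i lam))"

inductive cancels :: "(sign \<times> box) list \<Rightarrow> (sign \<times> box) list \<Rightarrow> bool" where
  "cancels (u @ (Minus, x) # (Plus, y) # v) (u @ v)"

definition reduced_word :: "(sign \<times> box) list \<Rightarrow> (sign \<times> box) list" where
  "reduced_word w = (THE v. cancels\<^sup>*\<^sup>* w v \<and> (\<nexists>u. cancels v u))"

definition reduced_ladder_signature :: "nat \<Rightarrow> int \<Rightarrow> box set \<Rightarrow> (sign \<times> box) list" where
  "reduced_ladder_signature l i lam = reduced_word (ladder_signature l i lam)"

definition remaining :: "sign \<Rightarrow> nat \<Rightarrow> int \<Rightarrow> box set \<Rightarrow> box list" where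
  "remaining s l i lam = map snd (filter (\<lambda>p. fst p = s) (reduced_ladder_signature l i lam))"

definition phi_hat :: "nat \<Rightarrow> int \<Rightarrow> box set \<Rightarrow> nat" where
  "phi_hat l i lam = length (remaining Plus l i lam)"

definition eps_hat :: "nat \<Rightarrow> int \<Rightarrow> box set \<Rightarrow> nat" where
  "eps_hat l i lam = length (remaining Minus l i lam)"

text \<open>The value \<open>0\<close> of the crystal operators is rendered as \<^const>\<open>None\<close>.\<close>

definition f_hat :: "nat \<Rightarrow> int \<Rightarrow> box set \<Rightarrow> box set option" where
  "f_hat l i lam = (let xs = remaining Plus l i lam in
     if xs = [] then None else Some (insert (last xs) lam))"

definition e_hat :: "nat \<Rightarrow> int \<Rightarrow> box set \<Rightarrow> box set option" where
  "e_hat l i lam = (let xs = remaining Minus l i lam in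
     if xs = [] then None else Some (lam - {hd xs}))"

primrec iterate :: "('a \<Rightarrow> 'a option) \<Rightarrow> nat \<Rightarrow> 'a \<Rightarrow> 'a option" where
  "iterate g 0 x = Some x"
| "iterate g (Suc n) x = Option.bind (iterate g n x) g"


text \<open>
  The remaining lemmas show that the definitions by \<^const>\<open>sorted_key_list_of_set\<close> (which
  needs a finite set and an injective key) and by a definite description are meaningful.
\<close>

lemma addable_next_to:
  assumes "(a, b) \<in> addable l i lam"
  shows "(a = 1 \<or> (a - 1, b) \<in> lam) \<and> (b = 1 \<or> (a, b - 1) \<in> lam)"
proof -
  have part: "is_partition (insert (a, b) lam)"
    using assms by (simp add: addable_def)
  then have pos: "1 \<le> a" "1 \<le> b"
    and down: "\<And>c d. 1 \<le> c \<Longrightarrow> c \<le> a \<Longrightarrow> 1 \<le> d \<Longrightarrow> d \<le> b \<Longrightarrow> (c, d) \<in> insert (a, b) lam"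
    unfolding is_partition_def by auto
  have "a = 1 \<or> (a - 1, b) \<in> lam"
    using down[of "a - 1" b] pos by (cases "a = 1") (auto simp: Suc_le_eq)
  moreover have "b = 1 \<or> (a, b - 1) \<in> lam"
    using down[of a "b - 1"] pos by (cases "b = 1") (auto simp: Suc_le_eq)
  ultimately show ?thesis ..
qed

lemma finite_addable_removable:
  assumes "is_partition lam"
  shows "finite (addable l i lam \<union> removable l i lam)"
proof -
  have fin: "finite lam"
    using assms by (simp add: is_partition_def)
  have "addable l i lam \<subseteq>
      insert (1, 1) ((\<lambda>(a, b). (Suc a, b)) ` lam \<union> (\<lambda>(a, b). (a, Suc b)) ` lam)" (is "_ \<subseteq> ?B")
  proof
    fix x assume x: "x \<in> addable l i lam"
    obtain a b where ab: "x = (a, b)" by (cases x)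
    have pos: "1 \<le> a" "1 \<le> b"
      using x ab by (auto simp: addable_def is_partition_def)
    consider "a = 1" "b = 1" | "(a - 1, b) \<in> lam" | "(a, b - 1) \<in> lam"
      using addable_next_to x ab by blast
    then show "x \<in> ?B"
      using ab pos by cases (force simp: image_iff)+
  qed
  then have "finite (addable l i lam)"
    by (rule finite_subset) (use fin in simp)
  moreover have "finite (removable l i lam)"
    using fin by (simp add: removable_def)
  ultimately show ?thesis by simp
qed

lemma inj_reading_key:
  assumes "2 \<le> l"
  shows "inj_on (reading_key l) A"
  using assms by (auto simp: inj_on_def reading_key_def ladder_value_def)

lemma (in linorder) set_sorted_key_list_of_set_inj:
  assumes "inj_on f UNIV" and "finite A"
  shows "set (sorted_key_list_of_set f A) = A"
proof -
  interpret folding_insort_key "(\<le>)" "(<)" UNIV f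
    by unfold_locales (rule assms(1))
  show ?thesis
    using assms(2) by simp
qed

lemma (in linorder) strict_sorted_key_list_of_set_inj:
  assumes "inj_on f UNIV"
  shows "sorted_wrt (<) (map f (sorted_key_list_of_set f A))"
proof -
  interpret folding_insort_key "(\<le>)" "(<)" UNIV f
    by unfold_locales (rule assms)
  show ?thesis
    by simp
qed

lemma ladder_signature_props:
  assumes "2 \<le> l" and "is_partition lam"
  shows "set (ladder_signature l i lam) = Pair Plus ` addable l i lam \<union> Pair Minus ` removable l i lam"
    and "sorted_wrt (\<lambda>p q. reading_key l (snd p) < reading_key l (snd q)) (ladder_signature l i lam)"
proof -
  let ?A = "addable l i lam \<union> removable l i lam"
  let ?xs = "sorted_key_list_of_set (reading_key l) ?A"
  have fin: "finite ?A"
    by (rule finite_addable_removable[OF assms(2)])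
  have disj: "x \<notin> addable l i lam" if "x \<in> removable l i lam" for x
    using that by (simp add: addable_def removable_def)
  have "set ?xs = ?A"
    by (rule set_sorted_key_list_of_set_inj[OF inj_reading_key[OF assms(1)] fin])
  then show "set (ladder_signature l i lam) =
      Pair Plus ` addable l i lam \<union> Pair Minus ` removable l i lam"
    using disj by (simp add: ladder_signature_def image_Un)
  have "sorted_wrt (<) (map (reading_key l) ?xs)"
    by (rule strict_sorted_key_list_of_set_inj[OF inj_reading_key[OF assms(1)]])
  then show "sorted_wrt (\<lambda>p q. reading_key l (snd p) < reading_key l (snd q))
      (ladder_signature l i lam)"
    by (simp add: ladder_signature_def sorted_wrt_map)
qed

fun reduce :: "(sign \<times> box) list \<Rightarrow> (sign \<times> box) list" where
  "reduce [] = []"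
| "reduce ((Plus, x) # w) = (Plus, x) # reduce w"
| "reduce ((Minus, x) # w) =
     (case reduce w of (Plus, y) # v \<Rightarrow> v | v \<Rightarrow> (Minus, x) # v)"

lemma cancels_Cons: "cancels w v \<Longrightarrow> cancels (p # w) (p # v)"
  by (auto simp: cancels.simps) (metis append_Cons)

lemma cancels_rtranclp_Cons: "cancels\<^sup>*\<^sup>* w v \<Longrightarrow> cancels\<^sup>*\<^sup>* (p # w) (p # v)"
  by (induction rule: rtranclp_induct) (auto intro: rtranclp.rtrancl_into_rtrancl cancels_Cons)

lemma cancels_reduce: "cancels\<^sup>*\<^sup>* w (reduce w)"
proof (induction w rule: reduce.induct)
  case (3 x w)
  have *: "cancels\<^sup>*\<^sup>* ((Minus, x) # w) ((Minus, x) # reduce w)"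
    using 3 by (rule cancels_rtranclp_Cons)
  show ?case
  proof (cases "\<exists>y v. reduce w = (Plus, y) # v")
    case True
    then obtain y v where v: "reduce w = (Plus, y) # v" by blast
    have "cancels ((Minus, x) # reduce w) v"
      using cancels.intros[of "[]" x y v] v by simp
    with * show ?thesis
      by (simp add: v rtranclp.rtrancl_into_rtrancl)
  next
    case False
    then have "reduce ((Minus, x) # w) = (Minus, x) # reduce w"
      by (auto split: list.split sign.split prod.split)
    with * show ?thesis by simp
  qed
qed (auto intro: cancels_rtranclp_Cons)

lemma reduce_append_cong: "reduce v = reduce v' \<Longrightarrow> reduce (u @ v) = reduce (u @ v')"
  by (induction u rule: reduce.induct) auto

lemma reduce_cancels: "cancels w v \<Longrightarrow> reduce w = reduce v"
  by (induction rule: cancels.induct) (auto intro: reduce_append_cong)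

lemma reduce_cancels_rtranclp: "cancels\<^sup>*\<^sup>* w v \<Longrightarrow> reduce w = reduce v"
  by (induction rule: rtranclp_induct) (auto dest: reduce_cancels)

lemma reduce_sorted: "\<exists>ps ms. reduce w = map (Pair Plus) ps @ map (Pair Minus) ms"
proof (induction w rule: reduce.induct)
  case 1
  then show ?case by simp
next
  case (2 x w)
  then obtain ps ms where "reduce w = map (Pair Plus) ps @ map (Pair Minus) ms" by blast
  then have "reduce ((Plus, x) # w) = map (Pair Plus) (x # ps) @ map (Pair Minus) ms" by simp
  then show ?case by blast
next
  case (3 x w)
  then obtain ps ms where w: "reduce w = map (Pair Plus) ps @ map (Pair Minus) ms" by blast
  show ?case
  proof (cases ps)
    case Nil
    then have "reduce ((Minus, x) # w) = map (Pair Plus) [] @ map (Pair Minus) (x # ms)"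
      using w by (cases ms) auto
    then show ?thesis by blast
  next
    case (Cons y ps')
    then show ?thesis using w by auto
  qed
qed

lemma irreducible_sorted: "\<not> cancels (map (Pair Plus) ps @ map (Pair Minus) ms) u"
proof
  assume "cancels (map (Pair Plus) ps @ map (Pair Minus) ms) u"
  then show False
  proof (induction ps arbitrary: u)
    case Nil
    then obtain t x y v where "map (Pair Minus) ms = t @ (Minus, x) # (Plus, y) # v"
      by (auto simp: cancels.simps)
    then have "(Plus, y) \<in> set (map (Pair Minus) ms)" by simp
    then show ?case by auto
  next
    case (Cons p ps)
    then obtain t x y v
      where eq: "(Plus, p) # map (Pair Plus) ps @ map (Pair Minus) ms
                 = t @ (Minus, x) # (Plus, y) # v"
      by (auto simp: cancels.simps)
    then obtain q t' where "t = q # t'" by (cases t) auto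
    then have "cancels (map (Pair Plus) ps @ map (Pair Minus) ms) (t' @ v)"
      using eq by (auto intro: cancels.intros)
    then show ?case by (rule Cons.IH)
  qed
qed

lemma reduced_word_iff: "cancels\<^sup>*\<^sup>* w v \<and> (\<nexists>u. cancels v u) \<longleftrightarrow> v = reduce w"
proof
  assume v: "cancels\<^sup>*\<^sup>* w v \<and> (\<nexists>u. cancels v u)"
  then have "reduce v = v"
    using cancels_reduce[of v] by (metis converse_rtranclpE)
  then show "v = reduce w"
    using v reduce_cancels_rtranclp by metis
next
  assume "v = reduce w"
  then show "cancels\<^sup>*\<^sup>* w v \<and> (\<nexists>u. cancels v u)"
    using cancels_reduce reduce_sorted[of w] irreducible_sorted by metis
qed

lemma reduced_word_eq_reduce: "reduced_word w = reduce w"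
  unfolding reduced_word_def reduced_word_iff by simp

end

theory Submission
  imports Defs
begin

text \<open>
  Read a partition as a bead configuration on \<open>\<int>\<close>: row \<open>a\<close> gives a bead at \<open>\<lambda>\<^sub>a - a\<close>, column \<open>b\<close>
  gives a gap at \<open>b - 1 - \<lambda>'\<^sub>b\<close>, every integer is exactly one of the two, and the hook length of
  \<open>(a, b)\<close> is bead minus gap. The JM condition then says: whenever a bead \<open>x\<close> lies above a gap \<open>y\<close>
  in the same class mod \<open>l\<close>, either all gaps below \<open>x\<close> or all beads above \<open>y\<close> lie in that class.

  An addable \<open>i\<close>-box is a bead at some \<open>p \<equiv> i - 1\<close> with a gap at \<open>p + 1\<close>; a removable one is a
  gap at \<open>q \<equiv> i - 1\<close> with a bead at \<open>q + 1\<close>. If both occur in a JM partition, the condition makes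
  the stretch between \<open>p\<close> and \<open>q\<close> so full (\<open>q < p\<close>) or so empty (\<open>p < q\<close>) that the addable box always
  comes first in the reading order. Hence nothing cancels in the signature, and the two iterations
  add all addable, respectively remove all removable, \<open>i\<close>-boxes. On beads this replaces the
  runners \<open>i - 1\<close> and \<open>i\<close> by their intersection and union (in one order or the other), and
  a case distinction on the runner shows that the JM condition survives.
\<close>

section \<open>Rows, columns, beads and gaps of a partition\<close>

definition row_len :: "box set \<Rightarrow> nat \<Rightarrow> nat" where
  "row_len lam a = card {d. (a, d) \<in> lam}"

definition col_len :: "box set \<Rightarrow> nat \<Rightarrow> nat" where
  "col_len lam b = card {c. (c, b) \<in> lam}"

definition bead :: "box set \<Rightarrow> nat \<Rightarrow> int" where
  "bead lam a = int (row_len lam a) - int a"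

definition gap :: "box set \<Rightarrow> nat \<Rightarrow> int" where
  "gap lam b = int b - 1 - int (col_len lam b)"

text \<open>Empty rows are included and contribute \<open>- a\<close>, so every sufficiently
  negative integer is a bead: this is the Maya diagram of the partition.\<close>

definition beads :: "box set \<Rightarrow> int set" where
  "beads lam = bead lam ` {1..}"

lemma down_closed_eq_atLeastAtMost:
  fixes S :: "nat set"
  assumes "finite S" "0 \<notin> S" "\<And>m n. n \<in> S \<Longrightarrow> 1 \<le> m \<Longrightarrow> m \<le> n \<Longrightarrow> m \<in> S"
  shows "S = {1..card S}"
proof (cases "S = {}")
  case False
  have "S = {1..Max S}"
  proof
    show "S \<subseteq> {1..Max S}"
    proof
      fix n assume "n \<in> S"
      then have "n \<noteq> 0" "n \<le> Max S" using assms(2) Max_ge[OF assms(1)] by metis+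
      then show "n \<in> {1..Max S}" by simp
    qed
    show "{1..Max S} \<subseteq> S"
      using assms(3)[OF Max_in[OF assms(1) False]] by auto
  qed
  then show ?thesis by (metis card_atLeastAtMost diff_Suc_1)
qed simp

lemma partition_pos: "is_partition lam \<Longrightarrow> (a, b) \<in> lam \<Longrightarrow> 1 \<le> a \<and> 1 \<le> b"
  unfolding is_partition_def by auto

lemma partition_down:
  "is_partition lam \<Longrightarrow> (a, b) \<in> lam \<Longrightarrow> 1 \<le> c \<Longrightarrow> c \<le> a \<Longrightarrow> 1 \<le> d \<Longrightarrow> d \<le> b \<Longrightarrow> (c, d) \<in> lam"
  unfolding is_partition_def by auto

lemma partition_row:
  assumes "is_partition lam"
  shows "{d. (a, d) \<in> lam} = {1..row_len lam a}"
  unfolding row_len_def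
proof (rule down_closed_eq_atLeastAtMost)
  have "finite (snd ` lam)" using assms by (simp add: is_partition_def)
  then show "finite {d. (a, d) \<in> lam}" by (rule rev_finite_subset) force
  show "0 \<notin> {d. (a, d) \<in> lam}" using partition_pos[OF assms] by fastforce
  show "m \<in> {d. (a, d) \<in> lam}" if "n \<in> {d. (a, d) \<in> lam}" "1 \<le> m" "m \<le> n" for m n
    using that partition_pos[OF assms, of a n] partition_down[OF assms, of a n a m] by auto
qed

lemma partition_col:
  assumes "is_partition lam"
  shows "{c. (c, b) \<in> lam} = {1..col_len lam b}"
  unfolding col_len_def
proof (rule down_closed_eq_atLeastAtMost)
  have "finite (fst ` lam)" using assms by (simp add: is_partition_def)
  then show "finite {c. (c, b) \<in> lam}" by (rule rev_finite_subset) force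
  show "0 \<notin> {c. (c, b) \<in> lam}" using partition_pos[OF assms] by fastforce
  show "m \<in> {c. (c, b) \<in> lam}" if "n \<in> {c. (c, b) \<in> lam}" "1 \<le> m" "m \<le> n" for m n
    using that partition_pos[OF assms, of n b] partition_down[OF assms, of n b m b] by auto
qed

lemma mem_iff_row: "is_partition lam \<Longrightarrow> (a, b) \<in> lam \<longleftrightarrow> 1 \<le> b \<and> b \<le> row_len lam a"
  using partition_row[of lam a] by (metis atLeastAtMost_iff mem_Collect_eq)

lemma mem_iff_col: "is_partition lam \<Longrightarrow> (a, b) \<in> lam \<longleftrightarrow> 1 \<le> a \<and> a \<le> col_len lam b"
  using partition_col[of lam b] by (metis atLeastAtMost_iff mem_Collect_eq)

lemma row_len_antimono:
  assumes "is_partition lam" "1 \<le> a" "a \<le> a'"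
  shows "row_len lam a' \<le> row_len lam a"
proof (cases "row_len lam a' = 0")
  case False
  then have "(a', row_len lam a') \<in> lam"
    using mem_iff_row[OF assms(1)] by simp
  then have "(a, row_len lam a') \<in> lam"
    using partition_down[OF assms(1)] assms(2,3) False by simp
  then show ?thesis using mem_iff_row[OF assms(1)] by blast
qed simp

lemma col_len_antimono:
  assumes "is_partition lam" "1 \<le> b" "b \<le> b'"
  shows "col_len lam b' \<le> col_len lam b"
proof (cases "col_len lam b' = 0")
  case False
  then have "(col_len lam b', b') \<in> lam"
    using mem_iff_col[OF assms(1)] by simp
  then have "(col_len lam b', b) \<in> lam"
    using partition_down[OF assms(1)] assms(2,3) False by simp
  then show ?thesis using mem_iff_col[OF assms(1)] by blast
qed simp

lemma bead_strict_decreasing: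
  "is_partition lam \<Longrightarrow> 1 \<le> a \<Longrightarrow> a < a' \<Longrightarrow> bead lam a' < bead lam a"
  using row_len_antimono[of lam a a'] by (simp add: bead_def)

lemma gap_strict_increasing:
  "is_partition lam \<Longrightarrow> 1 \<le> b \<Longrightarrow> b < b' \<Longrightarrow> gap lam b < gap lam b'"
  using col_len_antimono[of lam b b'] by (simp add: gap_def)

lemma bead_less_iff:
  assumes "is_partition lam" "1 \<le> a" "1 \<le> a'"
  shows "bead lam a' < bead lam a \<longleftrightarrow> a < a'"
  using bead_strict_decreasing[OF assms(1), of a a'] bead_strict_decreasing[OF assms(1), of a' a] assms
  by (cases a a' rule: linorder_cases) auto

lemma gap_less_iff:
  assumes "is_partition lam" "1 \<le> b" "1 \<le> b'"
  shows "gap lam b < gap lam b' \<longleftrightarrow> b < b'"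
  using gap_strict_increasing[OF assms(1), of b b'] gap_strict_increasing[OF assms(1), of b' b] assms
  by (cases b b' rule: linorder_cases) auto

text \<open>Bead minus gap equals \<open>(row_len lam a - b) + (col_len lam b - a) + 1\<close> over
  the integers. Both brackets are nonnegative when the box lies in the diagram and both are negative
  otherwise, so the difference is at least 1 or at most -1. The value 0 never occurs, which is why
  beads and gaps are disjoint.\<close>

lemma mem_iff_gap_less_bead:
  assumes "is_partition lam" "1 \<le> a" "1 \<le> b"
  shows "(a, b) \<in> lam \<longleftrightarrow> gap lam b < bead lam a"
  using mem_iff_row[OF assms(1), of a b] mem_iff_col[OF assms(1), of a b] assms
  unfolding gap_def bead_def by linarith

lemma gap_neq_bead:
  assumes "is_partition lam" "1 \<le> a" "1 \<le> b"
  shows "gap lam b \<noteq> bead lam a"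
  using mem_iff_row[OF assms(1), of a b] mem_iff_col[OF assms(1), of a b] assms
  unfolding gap_def bead_def by linarith

text \<open>Take the first row \<open>a\<close> whose bead is at most \<open>z\<close>. As
  \<open>z\<close> is not a bead, row \<open>a\<close> stops before the diagonal of content
  \<open>z\<close>, whereas row \<open>a - 1\<close>, if there is one, reaches the column
  \<open>b\<close> in which row \<open>a\<close> meets that diagonal. So column \<open>b\<close> has
  length \<open>a - 1\<close>, and its gap is \<open>b - a = z\<close>.\<close>

lemma bead_or_gap:
  assumes "is_partition lam" "z \<notin> beads lam"
  obtains b where "1 \<le> b" "gap lam b = z"
proof -
  let ?P = "\<lambda>a. 1 \<le> a \<and> bead lam a \<le> z"
  \<comment> \<open>A row so far down that its bead is certainly at most \<open>z\<close>; it makes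
    the \<open>LEAST\<close> below meaningful.\<close>
  define n where "n = nat (\<bar>z\<bar> + bead lam 1) + 2"
  have "bead lam n \<le> bead lam 1 + 1 - int n"
    using row_len_antimono[OF assms(1), of 1 n] by (simp add: bead_def n_def)
  then have "?P n" unfolding n_def by linarith
  define a where "a = (LEAST a. ?P a)"
  have a: "1 \<le> a" "bead lam a \<le> z"
    using LeastI[of ?P, OF \<open>?P n\<close>] unfolding a_def by auto
  have less: "\<not> ?P (a - 1)"
    using not_less_Least[of "a - 1" ?P] a(1) unfolding a_def by linarith
  have ne: "bead lam a \<noteq> z" using assms(2) a(1) unfolding beads_def by auto
  \<comment> \<open>The box \<open>(a, b)\<close> has content \<open>z\<close>; \<open>b\<close> is
    positive because the bead of row \<open>a\<close> is strictly below \<open>z\<close>.\<close>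
  define b where "b = nat (z + int a)"
  have zb: "z + int a = int b" "1 \<le> b"
    using a ne unfolding b_def bead_def by linarith+
  have "(a, b) \<notin> lam" using mem_iff_row[OF assms(1)] a ne zb unfolding bead_def by auto
  then have "col_len lam b < a" using mem_iff_col[OF assms(1), of a b] a(1) by linarith
  moreover have "a - 1 \<le> col_len lam b"
  proof (cases "a = 1")
    case False
    then have "z < bead lam (a - 1)" using less a(1) by linarith
    then have "b \<le> row_len lam (a - 1)" using zb a(1) False unfolding bead_def by linarith
    then show ?thesis using mem_iff_row[OF assms(1)] mem_iff_col[OF assms(1)] zb(2) by blast
  qed simp
  ultimately have "gap lam b = z" using zb unfolding gap_def by linarith
  with zb(2) show ?thesis by (rule that)
qed

lemma gap_notin_beads: "is_partition lam \<Longrightarrow> 1 \<le> b \<Longrightarrow> gap lam b \<notin> beads lam"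
  using gap_neq_bead unfolding beads_def by force

lemma bead_in_beads: "1 \<le> a \<Longrightarrow> bead lam a \<in> beads lam"
  unfolding beads_def by simp

section \<open>Hook lengths and the JM condition on beads\<close>

lemma hook_length_eq:
  assumes "is_partition lam" "(a, b) \<in> lam"
  shows "int (hook_length lam a b) = bead lam a - gap lam b"
proof -
  have pos: "1 \<le> a" "1 \<le> b" using partition_pos[OF assms] by auto
  \<comment> \<open>The hook is cut into the arm, which keeps the corner, and the leg, which starts
    one row lower.\<close>
  have "{(c, d) \<in> lam. (c = a \<and> b \<le> d) \<or> (d = b \<and> a \<le> c)}
      = Pair a ` {b..row_len lam a} \<union> (\<lambda>c. (c, b)) ` {Suc a..col_len lam b}"
    (is "?L = ?R")
  proof (rule set_eqI)
    fix p :: box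
    obtain c d where p: "p = (c, d)" by (cases p)
    have "p \<in> ?R \<longleftrightarrow> c = a \<and> b \<le> d \<and> d \<le> row_len lam a \<or> d = b \<and> a < c \<and> c \<le> col_len lam b"
      unfolding p by auto
    moreover have "p \<in> ?L \<longleftrightarrow> (c, d) \<in> lam \<and> (c = a \<and> b \<le> d \<or> d = b \<and> a \<le> c)"
      unfolding p by simp
    ultimately show "p \<in> ?L \<longleftrightarrow> p \<in> ?R"
      using mem_iff_row[OF assms(1), of a d] mem_iff_col[OF assms(1), of c b] pos assms(2)
        le_neq_implies_less[of a c] by auto
  qed
  moreover have "card (Pair a ` {b..row_len lam a} \<union> (\<lambda>c. (c, b)) ` {Suc a..col_len lam b})
      = (Suc (row_len lam a) - b) + (col_len lam b - a)"
    by (subst card_Un_disjoint) (auto simp: card_image inj_on_def)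
  moreover have "b \<le> row_len lam a" "a \<le> col_len lam b"
    using mem_iff_row[OF assms(1)] mem_iff_col[OF assms(1)] assms(2) by auto
  ultimately show ?thesis
    unfolding hook_length_def bead_def gap_def by simp
qed

text \<open>The bead \<open>x\<close> stands for a row and the gap \<open>y\<close> for a column,
  and they meet in a box whose hook length is divisible by \<open>l\<close>. The two alternatives
  say that all hook lengths in that row, or all in that column, are divisible by \<open>l\<close>;
  this is the forbidden triple turned into a disjunction.\<close>

definition JM_beads :: "int \<Rightarrow> int set \<Rightarrow> bool" where
  "JM_beads l B \<longleftrightarrow> (\<forall>x\<in>B. \<forall>y. y \<notin> B \<longrightarrow> y < x \<longrightarrow> x mod l = y mod l \<longrightarrow>
     (\<forall>z. z \<notin> B \<longrightarrow> z < x \<longrightarrow> z mod l = x mod l) \<or> (\<forall>z\<in>B. y < z \<longrightarrow> z mod l = y mod l))"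

lemma JM_partition_iff_beads:
  "JM_partition l lam \<longleftrightarrow> is_partition lam \<and> JM_beads (int l) (beads lam)"
proof (cases "is_partition lam")
  case True
  have dvd: "l dvd hook_length lam a b \<longleftrightarrow> bead lam a mod int l = gap lam b mod int l"
    if "(a, b) \<in> lam" for a b
    using hook_length_eq[OF True that] by (metis int_dvd_int_iff mod_eq_dvd_iff)
  show ?thesis
  proof
    assume JM: "JM_partition l lam"
    have "JM_beads (int l) (beads lam)"
      unfolding JM_beads_def
    proof (intro ballI allI impI, rule ccontr)
      fix x y
      assume "x \<in> beads lam" "y \<notin> beads lam" "y < x" "x mod int l = y mod int l"
        and "\<not> ((\<forall>z. z \<notin> beads lam \<longrightarrow> z < x \<longrightarrow> z mod int l = x mod int l) \<or>
                (\<forall>z\<in>beads lam. y < z \<longrightarrow> z mod int l = y mod int l))"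
      \<comment> \<open>The failure of both alternatives supplies a gap \<open>y'\<close> and a bead
        \<open>x'\<close>. They become the column \<open>d\<close> and the row \<open>c\<close> of
        the two other boxes in a forbidden triple.\<close>
      then obtain y' x' where *: "y' \<notin> beads lam" "y' < x" "y' mod int l \<noteq> x mod int l"
        "x' \<in> beads lam" "y < x'" "x' mod int l \<noteq> y mod int l" by blast
      obtain a where a: "1 \<le> a" "x = bead lam a" using \<open>x \<in> beads lam\<close> unfolding beads_def by auto
      obtain c where c: "1 \<le> c" "x' = bead lam c" using * unfolding beads_def by auto
      obtain b where b: "1 \<le> b" "gap lam b = y" using bead_or_gap[OF True \<open>y \<notin> beads lam\<close>] by blast
      obtain d where d: "1 \<le> d" "gap lam d = y'" using bead_or_gap[OF True *(1)] by blast
      have "(a, b) \<in> lam" "(a, d) \<in> lam" "(c, b) \<in> lam"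
        using mem_iff_gap_less_bead[OF True] a b c d * \<open>y < x\<close> by auto
      moreover have "l dvd hook_length lam a b" "\<not> l dvd hook_length lam a d" "\<not> l dvd hook_length lam c b"
        using dvd calculation a b c d * \<open>x mod int l = y mod int l\<close> by auto
      ultimately show False using JM unfolding JM_partition_def by blast
    qed
    with True show "is_partition lam \<and> JM_beads (int l) (beads lam)" ..
  next
    assume JM: "is_partition lam \<and> JM_beads (int l) (beads lam)"
    have False if in_lam: "(a, b) \<in> lam" "(a, y) \<in> lam" "(x, b) \<in> lam"
      and h: "l dvd hook_length lam a b" "\<not> l dvd hook_length lam a y" "\<not> l dvd hook_length lam x b"
    for a b x y
    proof -
      have pos: "1 \<le> a" "1 \<le> b" "1 \<le> x" "1 \<le> y" using partition_pos[OF True] in_lam by auto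
      show False
        using JM[unfolded JM_beads_def, THEN conjunct2, rule_format, of "bead lam a" "gap lam b"]
          h[unfolded dvd[OF in_lam(1)] dvd[OF in_lam(2)] dvd[OF in_lam(3)]]
          in_lam[unfolded mem_iff_gap_less_bead[OF True pos(1,2)]
            mem_iff_gap_less_bead[OF True pos(1,4)] mem_iff_gap_less_bead[OF True pos(3,2)]]
          gap_notin_beads[OF True] bead_in_beads pos
        by metis
    qed
    then show "JM_partition l lam" using True unfolding JM_partition_def by blast
  qed
qed (simp add: JM_partition_def)

section \<open>Moving beads between two neighbouring runners\<close>

definition push_up :: "int \<Rightarrow> int \<Rightarrow> int set \<Rightarrow> int set" where
  "push_up l i B = {z. if (z + 1) mod l = i then z \<in> B \<and> z + 1 \<in> B
     else if z mod l = i then z \<in> B \<or> z - 1 \<in> B else z \<in> B}"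

definition push_down :: "int \<Rightarrow> int \<Rightarrow> int set \<Rightarrow> int set" where
  "push_down l i B = {z. if (z + 1) mod l = i then z \<in> B \<or> z + 1 \<in> B
     else if z mod l = i then z \<in> B \<and> z - 1 \<in> B else z \<in> B}"

lemma mod_succ_neq: "2 \<le> l \<Longrightarrow> (z + 1) mod l \<noteq> z mod (l::int)"
  by (auto simp: mod_eq_dvd_iff dest: zdvd_imp_le)

lemma mod_succ_cong: "(y + 1) mod l = (z + 1) mod l \<longleftrightarrow> y mod l = z mod (l::int)"
  by (simp add: mod_eq_dvd_iff)

lemma mod_succ_eq_iff: "(y + 1) mod l = z mod l \<longleftrightarrow> y mod l = (z - 1) mod (l::int)"
  using mod_succ_cong[of y l "z - 1"] by simp

lemma JM_beadsD:
  assumes "JM_beads l B" "x \<in> B" "y \<notin> B" "y < x" "x mod l = y mod l"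
  shows "(\<forall>z. z \<notin> B \<longrightarrow> z < x \<longrightarrow> z mod l = x mod l) \<or> (\<forall>z. z \<in> B \<longrightarrow> y < z \<longrightarrow> z mod l = y mod l)"
  using assms unfolding JM_beads_def by blast

text \<open>Since \<open>x\<close> and \<open>y\<close> share a class, three cases suffice. On the
  lower runner \<open>x\<close> and \<open>x + 1\<close> are both beads of \<open>B\<close>, while
  \<open>y\<close> or \<open>y + 1\<close> is a gap. The condition is applied to \<open>x\<close>,
  \<open>y\<close> or to \<open>x + 1\<close>, \<open>y + 1\<close>; the other one of the two beads
  refutes the alternative on beads, so the one on gaps holds and carries over. On the upper runner
  \<open>y\<close> and \<open>y - 1\<close> are both gaps and the roles are exchanged. Off the two
  runners \<open>x\<close> and \<open>y\<close> keep their status, and whichever alternative holds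
  for \<open>B\<close> carries over.\<close>

lemma JM_push_up:
  assumes l: "2 \<le> l" and JM: "JM_beads l B"
  shows "JM_beads l (push_up l i B)" (is "JM_beads l ?B'")
proof -
  define c where "c z = z mod l" for z
  note J = JM_beadsD[OF JM, folded c_def]
  have cs: "c (u + 1) = c (v + 1) \<longleftrightarrow> c u = c v" for u v
    unfolding c_def by (rule mod_succ_cong)
  have cp: "c (u + 1) = c v \<longleftrightarrow> c u = c (v - 1)" for u v
    unfolding c_def by (rule mod_succ_eq_iff)
  have neq0: "c (u + 1) \<noteq> c u" for u
    unfolding c_def by (rule mod_succ_neq[OF l])
  have neq: "c (u + 1) \<noteq> c u" "c u \<noteq> c (u + 1)" "c (u - 1) \<noteq> c u" "c u \<noteq> c (u - 1)" for u
    using neq0[of u] neq0[of "u - 1"] by auto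
  have mem: "z \<in> ?B' \<longleftrightarrow> (if c (z + 1) = i then z \<in> B \<and> z + 1 \<in> B
     else if c z = i then z \<in> B \<or> z - 1 \<in> B else z \<in> B)" for z
    unfolding push_up_def c_def by simp
  show ?thesis
    unfolding JM_beads_def c_def[symmetric]
  proof (intro ballI allI impI)
    fix x y
    assume x: "x \<in> ?B'" and y: "y \<notin> ?B'" and less: "y < x" and cong: "c x = c y"
    have cong1: "c (x + 1) = c (y + 1)" and cong2: "c (x - 1) = c (y - 1)"
      using cong cs[of x y] cs[of "x - 1" "y - 1"] by simp_all
    consider (lower) "c (x + 1) = i" | (upper) "c x = i" | (other) "c (x + 1) \<noteq> i" "c x \<noteq> i"
      by blast
    then show "(\<forall>z. z \<notin> ?B' \<longrightarrow> z < x \<longrightarrow> c z = c x) \<or> (\<forall>z\<in>?B'. y < z \<longrightarrow> c z = c y)"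
    proof cases
      case lower
      then have xB: "x \<in> B" "x + 1 \<in> B" and yB: "y \<notin> B \<or> y + 1 \<notin> B"
        using x y cong1 unfolding mem by auto
      from yB have "c z = c x" if z: "z \<notin> ?B'" "z < x" for z
      proof
        assume "y \<notin> B"
        with J[of x y] xB less cong have "\<forall>z. z \<notin> B \<longrightarrow> z < x \<longrightarrow> c z = c x"
          using neq(1)[of x] by (smt (verit))
        then show ?thesis
          using z lower cs[of z x] mem[of z] by (smt (verit))
      next
        assume "y + 1 \<notin> B"
        with J[of "x + 1" "y + 1"] xB less cong1 have "\<forall>z. z \<notin> B \<longrightarrow> z < x + 1 \<longrightarrow> c z = c (x + 1)"
          using neq(2)[of x] by (smt (verit))
        then show ?thesis
          using z lower cs[of z x] neq[of z] mem[of z] by (smt (verit))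
      qed
      then show ?thesis by blast
    next
      case upper
      then have yB: "y \<notin> B" "y - 1 \<notin> B" and xB: "x \<in> B \<or> x - 1 \<in> B"
        using x y cong cong1 neq[of x] unfolding mem by (auto split: if_splits)
      from xB have "c z = c y" if z: "z \<in> ?B'" "y < z" for z
      proof
        assume "x \<in> B"
        with J[of x y] yB less cong have "\<forall>z. z \<in> B \<longrightarrow> y < z \<longrightarrow> c z = c y"
          using neq(3)[of y] by (smt (verit))
        then show ?thesis
          using z upper cong neq[of z] mem[of z] by (smt (verit))
      next
        assume "x - 1 \<in> B"
        with J[of "x - 1" "y - 1"] yB less cong2 have "\<forall>z. z \<in> B \<longrightarrow> y - 1 < z \<longrightarrow> c z = c (y - 1)"
          using neq(4)[of y] by (smt (verit))
        then show ?thesis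
          using z upper cong cp[of z y] neq[of z] mem[of z] by (smt (verit))
      qed
      then show ?thesis by blast
    next
      case other
      then have B: "x \<in> B" "y \<notin> B" using x y cong cong1 unfolding mem by auto
      from J[OF this less cong] show ?thesis
      proof
        assume *: "\<forall>z. z \<notin> B \<longrightarrow> z < x \<longrightarrow> c z = c x"
        have "c z = c x" if z: "z \<notin> ?B'" "z < x" for z
        proof (cases "c (z + 1) = i")
          case True
          \<comment> \<open>Below \<open>x\<close> all positions on the two runners are occupied, as
            gaps occur only in the class of \<open>x\<close>. Hence \<open>z\<close> and
            \<open>z + 1\<close> are both beads and \<open>z\<close> stays one, a contradiction. The
            bound is needed to apply this to \<open>z + 1\<close>.\<close>
          then have "z + 1 < x" using other z by (cases "z + 1 = x") auto
          then have "z + 1 \<in> B" using * True other by auto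
          then show ?thesis using * True z unfolding mem by auto
        next
          case False
          then show ?thesis using *[rule_format, of z] mem[of z] z other by (smt (verit))
        qed
        then show ?thesis by blast
      next
        assume *: "\<forall>z. z \<in> B \<longrightarrow> y < z \<longrightarrow> c z = c y"
        have "c z = c y" if z: "z \<in> ?B'" "y < z" for z
        proof (cases "c z = i")
          case True
          then have "y < z - 1" using other z cong1 by (cases "z = y + 1") auto
          then have "z - 1 \<notin> B" using * True other cong1 cs[of "z - 1" y] by auto
          then show ?thesis using * True z neq[of z] unfolding mem by auto
        next
          case False
          then show ?thesis using *[rule_format, of z] mem[of z] z other by (smt (verit))
        qed
        then show ?thesis by blast
      qed
    qed
  qed
qed

text \<open>The argument for \<open>push_up\<close> with the two runners interchanged: on the lower
  runner two gaps of \<open>B\<close> force the alternative on beads, on the upper runner two beads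
  force the one on gaps.\<close>

lemma JM_push_down:
  assumes l: "2 \<le> l" and JM: "JM_beads l B"
  shows "JM_beads l (push_down l i B)" (is "JM_beads l ?B'")
proof -
  define c where "c z = z mod l" for z
  note J = JM_beadsD[OF JM, folded c_def]
  have cs: "c (u + 1) = c (v + 1) \<longleftrightarrow> c u = c v" for u v
    unfolding c_def by (rule mod_succ_cong)
  have cp: "c (u + 1) = c v \<longleftrightarrow> c u = c (v - 1)" for u v
    unfolding c_def by (rule mod_succ_eq_iff)
  have neq0: "c (u + 1) \<noteq> c u" for u
    unfolding c_def by (rule mod_succ_neq[OF l])
  have neq: "c (u + 1) \<noteq> c u" "c u \<noteq> c (u + 1)" "c (u - 1) \<noteq> c u" "c u \<noteq> c (u - 1)" for u
    using neq0[of u] neq0[of "u - 1"] by auto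
  have mem: "z \<in> ?B' \<longleftrightarrow> (if c (z + 1) = i then z \<in> B \<or> z + 1 \<in> B
     else if c z = i then z \<in> B \<and> z - 1 \<in> B else z \<in> B)" for z
    unfolding push_down_def c_def by simp
  show ?thesis
    unfolding JM_beads_def c_def[symmetric]
  proof (intro ballI allI impI)
    fix x y
    assume x: "x \<in> ?B'" and y: "y \<notin> ?B'" and less: "y < x" and cong: "c x = c y"
    have cong1: "c (x + 1) = c (y + 1)" and cong2: "c (x - 1) = c (y - 1)"
      using cong cs[of x y] cs[of "x - 1" "y - 1"] by simp_all
    \<comment> \<open>Congruent positions are never adjacent. This places the gap
      \<open>y + 1\<close> below \<open>x\<close>, and the bead \<open>x - 1\<close> above
      \<open>y\<close>, where they refute the unwanted alternative.\<close>
    have aux: "y + 1 < x" using less cong neq(1)[of y] by (cases "y + 1 = x") auto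
    consider (lower) "c (x + 1) = i" | (upper) "c x = i" | (other) "c (x + 1) \<noteq> i" "c x \<noteq> i"
      by blast
    then show "(\<forall>z. z \<notin> ?B' \<longrightarrow> z < x \<longrightarrow> c z = c x) \<or> (\<forall>z\<in>?B'. y < z \<longrightarrow> c z = c y)"
    proof cases
      case lower
      then have yB: "y \<notin> B" "y + 1 \<notin> B" and xB: "x \<in> B \<or> x + 1 \<in> B"
        using x y cong1 unfolding mem by auto
      from xB have "c z = c y" if z: "z \<in> ?B'" "y < z" for z
      proof
        assume "x \<in> B"
        with J[of x y] yB less aux cong have "\<forall>z. z \<in> B \<longrightarrow> y < z \<longrightarrow> c z = c y"
          using neq(1)[of y] by (smt (verit))
        then show ?thesis
          using z lower cong1 cs[of z y] mem[of z] by (smt (verit))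
      next
        assume "x + 1 \<in> B"
        with J[of "x + 1" "y + 1"] yB less cong1 have *: "\<forall>z. z \<in> B \<longrightarrow> y + 1 < z \<longrightarrow> c z = c (y + 1)"
          using neq(2)[of y] by (smt (verit))
        show ?thesis
        \<comment> \<open>The alternative obtained at \<open>y + 1\<close> says nothing about
          \<open>y + 1\<close> itself. That position lies on the upper runner with \<open>y\<close>
          and \<open>y + 1\<close> both empty, so it stays empty. The upper case below has the
          mirror exception \<open>x - 1\<close>.\<close>
        proof (cases "z = y + 1")
          case True
          then show ?thesis using z yB lower cong1 neq[of z] unfolding mem by (auto split: if_splits)
        next
          case False
          then have "y + 1 < z" using z by simp
          then show ?thesis
            using * *[rule_format, of "z - 1"] z lower cong1 cs[of z y] neq[of z] yB
            mem[of z] by (smt (verit))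
        qed
      qed
      then show ?thesis by blast
    next
      case upper
      then have xB: "x \<in> B" "x - 1 \<in> B" and yB: "y \<notin> B \<or> y - 1 \<notin> B"
        using x y cong cong1 neq[of x] unfolding mem by (auto split: if_splits)
      from yB have "c z = c x" if z: "z \<notin> ?B'" "z < x" for z
      proof
        assume "y \<notin> B"
        with J[of x y] xB less aux cong have "\<forall>z. z \<notin> B \<longrightarrow> z < x \<longrightarrow> c z = c x"
          using neq(3)[of x] by (smt (verit))
        then show ?thesis
          using z upper cp[of z x] mem[of z] by (smt (verit))
      next
        assume "y - 1 \<notin> B"
        with J[of "x - 1" "y - 1"] xB less cong2 have *: "\<forall>z. z \<notin> B \<longrightarrow> z < x - 1 \<longrightarrow> c z = c (x - 1)"
          using neq(4)[of x] by (smt (verit))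
        show ?thesis
        proof (cases "z = x - 1")
          case True
          then show ?thesis using z xB upper unfolding mem by (auto split: if_splits)
        next
          case False
          then have "z < x - 1" using z by simp
          then show ?thesis
            using * *[rule_format, of "z + 1"] z upper cp[of z x] neq[of z] xB
            mem[of z] by (smt (verit))
        qed
      qed
      then show ?thesis by blast
    next
      case other
      then have B: "x \<in> B" "y \<notin> B" using x y cong cong1 unfolding mem by auto
      from J[OF this less cong] show ?thesis
      proof
        assume *: "\<forall>z. z \<notin> B \<longrightarrow> z < x \<longrightarrow> c z = c x"
        have "c z = c x" if z: "z \<notin> ?B'" "z < x" for z
        proof (cases "c z = i")
          case True
          then have "z - 1 \<in> B" "z \<in> B"
            using *[rule_format, of "z - 1"] *[rule_format, of z] z other cs[of "z - 1" x] by auto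
          then show ?thesis using True z neq[of z] unfolding mem by auto
        next
          case False
          then show ?thesis using *[rule_format, of z] mem[of z] z other by (smt (verit))
        qed
        then show ?thesis by blast
      next
        assume *: "\<forall>z. z \<in> B \<longrightarrow> y < z \<longrightarrow> c z = c y"
        have "c z = c y" if z: "z \<in> ?B'" "y < z" for z
        proof (cases "c (z + 1) = i")
          case True
          then have "z + 1 \<notin> B" using *[rule_format, of "z + 1"] z other cong by auto
          then show ?thesis using * True z unfolding mem by auto
        next
          case False
          then show ?thesis using *[rule_format, of z] mem[of z] z other by (smt (verit))
        qed
        then show ?thesis by blast
      qed
    qed
  qed
qed

section \<open>Adding and removing boxes of one residue\<close>

lemma partition_Suc_row: "is_partition lam \<Longrightarrow> (Suc a, b) \<in> lam \<Longrightarrow> 1 \<le> a \<Longrightarrow> (a, b) \<in> lam"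
  using partition_down[of lam "Suc a" b a b] partition_pos[of lam "Suc a" b] by simp

lemma partition_Suc_col: "is_partition lam \<Longrightarrow> (a, Suc b) \<in> lam \<Longrightarrow> 1 \<le> b \<Longrightarrow> (a, b) \<in> lam"
  using partition_down[of lam a "Suc b" a b] partition_pos[of lam a "Suc b"] by simp

lemma is_partition_Suc_I:
  assumes "finite lam" "\<And>a b. (a, b) \<in> lam \<Longrightarrow> 1 \<le> a \<and> 1 \<le> b"
    and Suc_row: "\<And>a b. (Suc a, b) \<in> lam \<Longrightarrow> 1 \<le> a \<Longrightarrow> (a, b) \<in> lam"
    and Suc_col: "\<And>a b. (a, Suc b) \<in> lam \<Longrightarrow> 1 \<le> b \<Longrightarrow> (a, b) \<in> lam"
  shows "is_partition lam"
proof -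
  have up: "(c, b) \<in> lam" if "c \<le> a" "(a, b) \<in> lam" "1 \<le> c" for a b c
    using that
  proof (induction rule: inc_induct)
    case (step n)
    then show ?case using Suc_row[of n b] by simp
  qed
  have left: "(a, d) \<in> lam" if "d \<le> b" "(a, b) \<in> lam" "1 \<le> d" for a b d
    using that
  proof (induction rule: inc_induct)
    case (step n)
    then show ?case using Suc_col[of a n] by simp
  qed
  have "(c, d) \<in> lam" if "(a, b) \<in> lam" "1 \<le> c" "c \<le> a" "1 \<le> d" "d \<le> b" for a b c d
    using up[OF that(3) left[OF that(5,1,4)] that(2)] .
  then show ?thesis using assms(1,2) unfolding is_partition_def by blast
qed

lemma addable_iff:
  assumes "is_partition lam"
  shows "(a, b) \<in> addable l i lam \<longleftrightarrow> (a, b) \<notin> lam \<and> residue l (a, b) = i \<and> 1 \<le> a \<and> 1 \<le> b \<and>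
    (a = 1 \<or> (a - 1, b) \<in> lam) \<and> (b = 1 \<or> (a, b - 1) \<in> lam)" (is "_ \<longleftrightarrow> ?R")
proof
  assume A: "(a, b) \<in> addable l i lam"
  then have "is_partition (insert (a, b) lam)" by (simp add: addable_def)
  from partition_pos[OF this, of a b] A addable_next_to[OF A] show ?R
    by (simp add: addable_def)
next
  assume R: ?R
  have "is_partition (insert (a, b) lam)"
  proof (rule is_partition_Suc_I)
    show "finite (insert (a, b) lam)" using assms by (simp add: is_partition_def)
    show "1 \<le> c \<and> 1 \<le> d" if "(c, d) \<in> insert (a, b) lam" for c d
      using that R partition_pos[OF assms, of c d] by auto
    show "(c, d) \<in> insert (a, b) lam" if "(Suc c, d) \<in> insert (a, b) lam" "1 \<le> c" for c d
      using that R partition_Suc_row[OF assms, of c d] by auto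
    show "(c, d) \<in> insert (a, b) lam" if "(c, Suc d) \<in> insert (a, b) lam" "1 \<le> d" for c d
      using that R partition_Suc_col[OF assms, of c d] by auto
  qed
  with R show "(a, b) \<in> addable l i lam" by (simp add: addable_def)
qed

lemma removable_iff:
  assumes "is_partition lam"
  shows "(a, b) \<in> removable l i lam \<longleftrightarrow> (a, b) \<in> lam \<and> residue l (a, b) = i \<and>
    (Suc a, b) \<notin> lam \<and> (a, Suc b) \<notin> lam" (is "_ \<longleftrightarrow> ?R")
proof
  assume A: "(a, b) \<in> removable l i lam"
  then have P: "is_partition (lam - {(a, b)})" and m: "(a, b) \<in> lam" "residue l (a, b) = i"
    by (simp_all add: removable_def)
  then show ?R
    using partition_pos[OF assms m(1)] partition_Suc_row[OF P, of a b] partition_Suc_col[OF P, of a b] by auto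
next
  assume R: ?R
  have "is_partition (lam - {(a, b)})"
  proof (rule is_partition_Suc_I)
    show "finite (lam - {(a, b)})" using assms by (simp add: is_partition_def)
    show "1 \<le> c \<and> 1 \<le> d" if "(c, d) \<in> lam - {(a, b)}" for c d
      using that partition_pos[OF assms, of c d] by auto
    show "(c, d) \<in> lam - {(a, b)}" if "(Suc c, d) \<in> lam - {(a, b)}" "1 \<le> c" for c d
      using that R partition_Suc_row[OF assms, of c d] by auto
    show "(c, d) \<in> lam - {(a, b)}" if "(c, Suc d) \<in> lam - {(a, b)}" "1 \<le> d" for c d
      using that R partition_Suc_col[OF assms, of c d] by auto
  qed
  with R show "(a, b) \<in> removable l i lam" by (simp add: removable_def)
qed

lemma residue_Suc_neq:
  assumes "2 \<le> l"
  shows "residue l (Suc a, b) \<noteq> residue l (a, b)" "residue l (a, Suc b) \<noteq> residue l (a, b)"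
  using mod_succ_neq[of "int l" "int b - int (Suc a)"] mod_succ_neq[of "int l" "int b - int a"] assms
  by (auto simp: residue_def algebra_simps)

lemma residue_pred_neq:
  assumes "2 \<le> l" "1 \<le> a" "1 \<le> b"
  shows "residue l (a - 1, b) \<noteq> residue l (a, b)" "residue l (a, b - 1) \<noteq> residue l (a, b)"
  using residue_Suc_neq[OF assms(1), of "a - 1" b] residue_Suc_neq[OF assms(1), of a "b - 1"] assms
  by auto

lemma removable_not_addable: "x \<in> removable l i lam \<Longrightarrow> x \<notin> addable l i lam"
  by (simp add: addable_def removable_def)

text \<open>Boxes sharing an edge have different residues, so no box of \<open>S\<close> touches
  another \<open>i\<close>-box. Adding \<open>S\<close> thus neither blocks nor creates any other
  addable or removable \<open>i\<close>-box, and the members of \<open>S\<close> merely turn from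
  addable into removable.\<close>

lemma add_addables:
  assumes l: "2 \<le> l" and P: "is_partition lam" and S: "S \<subseteq> addable l i lam"
  shows partition_add_addables: "is_partition (lam \<union> S)"
    and addable_add_addables: "addable l i (lam \<union> S) = addable l i lam - S"
    and removable_add_addables: "removable l i (lam \<union> S) = removable l i lam \<union> S"
proof -
  have SD: "(a, b) \<notin> lam \<and> residue l (a, b) = i \<and> 1 \<le> a \<and> 1 \<le> b \<and>
    (a = 1 \<or> (a - 1, b) \<in> lam) \<and> (b = 1 \<or> (a, b - 1) \<in> lam)" if "(a, b) \<in> S" for a b
    using that S addable_iff[OF P] by blast
  show P': "is_partition (lam \<union> S)"
  proof (rule is_partition_Suc_I)
    have "finite S" using finite_addable_removable[OF P] S by (meson finite_Un finite_subset)
    then show "finite (lam \<union> S)" using P by (simp add: is_partition_def)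
    show "1 \<le> a \<and> 1 \<le> b" if "(a, b) \<in> lam \<union> S" for a b
      using that SD[of a b] partition_pos[OF P, of a b] by auto
    show "(a, b) \<in> lam \<union> S" if "(Suc a, b) \<in> lam \<union> S" "1 \<le> a" for a b
      using that SD[of "Suc a" b] partition_Suc_row[OF P, of a b] by auto
    show "(a, b) \<in> lam \<union> S" if "(a, Suc b) \<in> lam \<union> S" "1 \<le> b" for a b
      using that SD[of a "Suc b"] partition_Suc_col[OF P, of a b] by auto
  qed
  have "(a, b) \<in> addable l i (lam \<union> S) \<longleftrightarrow> (a, b) \<in> addable l i lam - S" for a b
    unfolding addable_iff[OF P'] Diff_iff addable_iff[OF P]
    using SD residue_pred_neq[OF l, of a b] by (metis Un_iff)
  then show "addable l i (lam \<union> S) = addable l i lam - S" by auto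
  have nb: "(Suc a, b) \<notin> lam" "(a, Suc b) \<notin> lam" if "(a, b) \<in> S" for a b
    using SD[OF that] partition_Suc_row[OF P, of a b] partition_Suc_col[OF P, of a b] by blast+
  have "(a, b) \<in> removable l i (lam \<union> S) \<longleftrightarrow> (a, b) \<in> removable l i lam \<union> S" for a b
    unfolding removable_iff[OF P'] Un_iff removable_iff[OF P]
    using SD nb residue_Suc_neq[OF l, of a b] by metis
  then show "removable l i (lam \<union> S) = removable l i lam \<union> S" by auto
qed

lemma remove_removables:
  assumes l: "2 \<le> l" and P: "is_partition lam" and S: "S \<subseteq> removable l i lam"
  shows partition_remove_removables: "is_partition (lam - S)"
    and addable_remove_removables: "addable l i (lam - S) = addable l i lam \<union> S"
    and removable_remove_removables: "removable l i (lam - S) = removable l i lam - S"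
proof -
  have SD: "(a, b) \<in> lam \<and> residue l (a, b) = i \<and> (Suc a, b) \<notin> lam \<and> (a, Suc b) \<notin> lam"
    if "(a, b) \<in> S" for a b
    using that S removable_iff[OF P] by blast
  show P': "is_partition (lam - S)"
  proof (rule is_partition_Suc_I)
    show "finite (lam - S)" using P by (simp add: is_partition_def)
    show "1 \<le> a \<and> 1 \<le> b" if "(a, b) \<in> lam - S" for a b
      using that partition_pos[OF P, of a b] by auto
    show "(a, b) \<in> lam - S" if "(Suc a, b) \<in> lam - S" "1 \<le> a" for a b
      using that SD[of a b] partition_Suc_row[OF P, of a b] by auto
    show "(a, b) \<in> lam - S" if "(a, Suc b) \<in> lam - S" "1 \<le> b" for a b
      using that SD[of a b] partition_Suc_col[OF P, of a b] by auto
  qed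
  have nb: "1 \<le> a" "1 \<le> b" "a = 1 \<or> (a - 1, b) \<in> lam" "b = 1 \<or> (a, b - 1) \<in> lam" if "(a, b) \<in> lam" for a b
  proof -
    show "1 \<le> a" "1 \<le> b" using partition_pos[OF P that] by auto
    then show "a = 1 \<or> (a - 1, b) \<in> lam" "b = 1 \<or> (a, b - 1) \<in> lam"
      using that partition_Suc_row[OF P, of "a - 1" b] partition_Suc_col[OF P, of a "b - 1"]
      by (cases "a = 1"; cases "b = 1"; simp)+
  qed
  have "(a, b) \<in> addable l i (lam - S) \<longleftrightarrow> (a, b) \<in> addable l i lam \<union> S" for a b
    unfolding addable_iff[OF P'] Un_iff addable_iff[OF P]
    using SD nb[of a b] residue_pred_neq[OF l, of a b] by (metis Diff_iff)
  then show "addable l i (lam - S) = addable l i lam \<union> S" by auto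
  have "(a, b) \<in> removable l i (lam - S) \<longleftrightarrow> (a, b) \<in> removable l i lam - S" for a b
    unfolding removable_iff[OF P'] Diff_iff removable_iff[OF P]
    using SD residue_Suc_neq[OF l, of a b] by metis
  then show "removable l i (lam - S) = removable l i lam - S" by auto
qed

section \<open>Addable and removable boxes as bead moves\<close>

lemma addable_iff_len:
  assumes P: "is_partition lam" and "1 \<le> a" "1 \<le> b"
  shows "(a, b) \<in> addable l i lam \<longleftrightarrow> residue l (a, b) = i \<and> row_len lam a = b - 1 \<and> col_len lam b = a - 1"
  unfolding addable_iff[OF P]
  using mem_iff_row[OF P, of a b] mem_iff_row[OF P, of a "b - 1"]
    mem_iff_col[OF P, of a b] mem_iff_col[OF P, of "a - 1" b] assms(2,3)
  by (auto simp: not_le)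

lemma removable_iff_len:
  assumes P: "is_partition lam" and "1 \<le> a" "1 \<le> b"
  shows "(a, b) \<in> removable l i lam \<longleftrightarrow> residue l (a, b) = i \<and> row_len lam a = b \<and> col_len lam b = a"
  unfolding removable_iff[OF P]
  using mem_iff_row[OF P, of a b] mem_iff_row[OF P, of a "Suc b"]
    mem_iff_col[OF P, of a b] mem_iff_col[OF P, of "Suc a" b] assms(2,3)
  by (auto simp: not_le)

text \<open>Once row \<open>a\<close> has length \<open>b - 1\<close>, the column condition becomes
  a condition on the position \<open>b - a\<close>. If it is not a bead, it is the gap of some
  column \<open>b'\<close>. The box \<open>(a, b')\<close> lies outside the diagram, so
  \<open>b \<le> b'\<close> and column \<open>b'\<close> is shorter than \<open>a\<close>; the value
  of the gap then leaves only \<open>b' = b\<close>.\<close>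

lemma addable_iff_beads:
  assumes P: "is_partition lam" and pos: "1 \<le> a" "1 \<le> b"
  shows "(a, b) \<in> addable l i lam \<longleftrightarrow>
    residue l (a, b) = i \<and> bead lam a = int b - int a - 1 \<and> int b - int a \<notin> beads lam"
proof -
  have "col_len lam b = a - 1 \<longleftrightarrow> int b - int a \<notin> beads lam" if row: "row_len lam a = b - 1"
  proof
    assume "col_len lam b = a - 1"
    then have "gap lam b = int b - int a" using pos by (simp add: gap_def of_nat_diff)
    then show "int b - int a \<notin> beads lam" using gap_notin_beads[OF P pos(2)] by simp
  next
    assume "int b - int a \<notin> beads lam"
    then obtain b' where b': "1 \<le> b'" "gap lam b' = int b - int a" by (rule bead_or_gap[OF P])
    have "bead lam a = int b - int a - 1" using row pos by (simp add: bead_def of_nat_diff)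
    then have "(a, b') \<notin> lam" using mem_iff_gap_less_bead[OF P pos(1) b'(1)] b' by simp
    then have "b \<le> b'" "col_len lam b' < a"
      using mem_iff_row[OF P, of a b'] mem_iff_col[OF P, of a b'] row pos b' by auto
    then have "b' = b" using b'(2) unfolding gap_def by linarith
    then show "col_len lam b = a - 1" using b'(2) pos unfolding \<open>b' = b\<close> gap_def by linarith
  qed
  moreover have "row_len lam a = b - 1 \<longleftrightarrow> bead lam a = int b - int a - 1"
    using pos unfolding bead_def by linarith
  ultimately show ?thesis unfolding addable_iff_len[OF assms] by blast
qed

lemma removable_iff_beads:
  assumes P: "is_partition lam" and pos: "1 \<le> a" "1 \<le> b"
  shows "(a, b) \<in> removable l i lam \<longleftrightarrow>
    residue l (a, b) = i \<and> bead lam a = int b - int a \<and> int b - int a - 1 \<notin> beads lam"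
proof -
  have "col_len lam b = a \<longleftrightarrow> int b - int a - 1 \<notin> beads lam" if row: "row_len lam a = b"
  proof
    assume "col_len lam b = a"
    then have "gap lam b = int b - int a - 1" using pos by (simp add: gap_def of_nat_diff)
    then show "int b - int a - 1 \<notin> beads lam" using gap_notin_beads[OF P pos(2)] by simp
  next
    assume "int b - int a - 1 \<notin> beads lam"
    then obtain b' where b': "1 \<le> b'" "gap lam b' = int b - int a - 1" by (rule bead_or_gap[OF P])
    have "bead lam a = int b - int a" using row pos by (simp add: bead_def of_nat_diff)
    then have "(a, b') \<in> lam" using mem_iff_gap_less_bead[OF P pos(1) b'(1)] b' by simp
    then have "b' \<le> b" "a \<le> col_len lam b'"
      using mem_iff_row[OF P, of a b'] mem_iff_col[OF P, of a b'] row by auto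
    then have "b' = b" using b'(2) unfolding gap_def by linarith
    then show "col_len lam b = a" using b'(2) pos unfolding \<open>b' = b\<close> gap_def by linarith
  qed
  moreover have "row_len lam a = b \<longleftrightarrow> bead lam a = int b - int a"
    using pos unfolding bead_def by linarith
  ultimately show ?thesis unfolding removable_iff_len[OF assms] by blast
qed

text \<open>The definition by membership suits the JM argument. This form moves each bead separately
  and so can be compared with the diagram row by row.\<close>

lemma push_up_eq_image:
  assumes "2 \<le> l"
  shows "push_up l i B = (\<lambda>x. if (x + 1) mod l = i \<and> x + 1 \<notin> B then x + 1 else x) ` B"
    (is "_ = ?g ` B")
proof (rule set_eqI)
  fix z
  have neq: "(z + 1) mod l \<noteq> z mod l" using mod_succ_neq[OF assms] .
  have "z \<in> ?g ` B \<longleftrightarrow> z \<in> B \<and> \<not> ((z + 1) mod l = i \<and> z + 1 \<notin> B) \<or>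
      z - 1 \<in> B \<and> z mod l = i \<and> z \<notin> B" (is "_ \<longleftrightarrow> ?R")
  proof
    assume "z \<in> ?g ` B"
    then obtain x where "x \<in> B" "z = ?g x" by blast
    then show ?R by (auto split: if_splits)
  next
    assume ?R
    then have "z \<in> B \<and> ?g z = z \<or> z - 1 \<in> B \<and> ?g (z - 1) = z" by auto
    then show "z \<in> ?g ` B" by (elim disjE conjE) (rule image_eqI[rotated], assumption, rule sym, assumption)+
  qed
  then show "z \<in> push_up l i B \<longleftrightarrow> z \<in> ?g ` B"
    unfolding push_up_def using neq by auto
qed

lemma push_down_eq_image:
  assumes "2 \<le> l"
  shows "push_down l i B = (\<lambda>x. if x mod l = i \<and> x - 1 \<notin> B then x - 1 else x) ` B"
    (is "_ = ?g ` B")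
proof (rule set_eqI)
  fix z
  have neq: "(z + 1) mod l \<noteq> z mod l" using mod_succ_neq[OF assms] .
  have "z \<in> ?g ` B \<longleftrightarrow> z \<in> B \<and> \<not> (z mod l = i \<and> z - 1 \<notin> B) \<or>
      z + 1 \<in> B \<and> (z + 1) mod l = i \<and> z \<notin> B" (is "_ \<longleftrightarrow> ?R")
  proof
    assume "z \<in> ?g ` B"
    then obtain x where "x \<in> B" "z = ?g x" by blast
    then show ?R by (auto split: if_splits)
  next
    assume ?R
    then have "z \<in> B \<and> ?g z = z \<or> z + 1 \<in> B \<and> ?g (z + 1) = z" by auto
    then show "z \<in> ?g ` B" by (elim disjE conjE) (rule image_eqI[rotated], assumption, rule sym, assumption)+
  qed
  then show "z \<in> push_down l i B \<longleftrightarrow> z \<in> ?g ` B"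
    unfolding push_down_def using neq by auto
qed

lemma row_len_eqI:
  assumes "\<And>d. (a, d) \<in> lam \<longleftrightarrow> 1 \<le> d \<and> d \<le> n"
  shows "row_len lam a = n"
proof -
  have "{d. (a, d) \<in> lam} = {1..n}"
    by (intro set_eqI) (simp only: assms mem_Collect_eq atLeastAtMost_iff)
  then show ?thesis by (simp add: row_len_def)
qed

text \<open>A row can gain only the box right after its end, and gaining it raises its bead by one.
  By \<open>addable_iff_beads\<close> this box is an addable \<open>i\<close>-box exactly when the
  bead may step onto a free position of class \<open>i\<close>.\<close>

lemma beads_add_addables:
  assumes l: "2 \<le> l" and P: "is_partition lam"
  shows "beads (lam \<union> addable l i lam) = push_up (int l) i (beads lam)"
proof -
  let ?A = "addable l i lam"
  let ?g = "\<lambda>x. if (x + 1) mod int l = i \<and> x + 1 \<notin> beads lam then x + 1 else x"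
  have "bead (lam \<union> ?A) a = ?g (bead lam a)" if a: "1 \<le> a" for a
  proof -
    define cond where "cond \<longleftrightarrow> (bead lam a + 1) mod int l = i \<and> bead lam a + 1 \<notin> beads lam"
    have new: "(a, d) \<in> ?A \<longleftrightarrow> cond \<and> d = Suc (row_len lam a)" for d
    proof (cases "1 \<le> d")
      case True
      show ?thesis
      proof (cases "d = Suc (row_len lam a)")
        case True
        then have e: "int d - int a = bead lam a + 1" by (simp add: bead_def)
        show ?thesis
          unfolding addable_iff_beads[OF P a \<open>1 \<le> d\<close>] cond_def residue_def prod.case e
          using True by simp
      next
        case False
        then have "bead lam a \<noteq> int d - int a - 1" unfolding bead_def by linarith
        then show ?thesis using False unfolding addable_iff_beads[OF P a \<open>1 \<le> d\<close>] by simp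
      qed
    next
      case False
      then show ?thesis unfolding addable_iff[OF P] by auto
    qed
    have "row_len (lam \<union> ?A) a = (if cond then Suc (row_len lam a) else row_len lam a)"
      by (rule row_len_eqI) (use new mem_iff_row[OF P] in auto)
    then show ?thesis unfolding cond_def[symmetric] by (simp add: bead_def)
  qed
  then have "beads (lam \<union> ?A) = ?g ` beads lam"
    unfolding beads_def image_image by (intro image_cong) auto
  also have "\<dots> = push_up (int l) i (beads lam)"
    using push_up_eq_image[of "int l" i "beads lam"] l by simp
  finally show ?thesis .
qed

lemma beads_remove_removables:
  assumes l: "2 \<le> l" and P: "is_partition lam"
  shows "beads (lam - removable l i lam) = push_down (int l) i (beads lam)"
proof -
  let ?M = "removable l i lam"
  let ?g = "\<lambda>x. if x mod int l = i \<and> x - 1 \<notin> beads lam then x - 1 else x"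
  have "bead (lam - ?M) a = ?g (bead lam a)" if a: "1 \<le> a" for a
  proof -
    define cond where "cond \<longleftrightarrow> bead lam a mod int l = i \<and> bead lam a - 1 \<notin> beads lam"
    \<comment> \<open>The bead of an empty row has the bead of the next row directly below it and
      cannot move down. Hence the natural subtraction \<open>row_len lam a - 1\<close> is not
      truncated where it is used.\<close>
    have pos: "1 \<le> row_len lam a" if cond
    proof (rule ccontr)
      assume "\<not> 1 \<le> row_len lam a"
      then have "bead lam (Suc a) = bead lam a - 1"
        using row_len_antimono[OF P a, of "Suc a"] unfolding bead_def by simp
      then show False using that bead_in_beads[of "Suc a" lam] unfolding cond_def by simp
    qed
    have gone: "(a, d) \<in> ?M \<longleftrightarrow> cond \<and> d = row_len lam a" for d
    proof (cases "1 \<le> d")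
      case True
      show ?thesis
      proof (cases "d = row_len lam a")
        case True
        then have e: "int d - int a = bead lam a" by (simp add: bead_def)
        show ?thesis
          unfolding removable_iff_beads[OF P a \<open>1 \<le> d\<close>] cond_def residue_def prod.case e
          using True by simp
      next
        case False
        then have "bead lam a \<noteq> int d - int a" unfolding bead_def by linarith
        then show ?thesis using False unfolding removable_iff_beads[OF P a \<open>1 \<le> d\<close>] by simp
      qed
    next
      case False
      then show ?thesis using pos partition_pos[OF P] unfolding removable_iff[OF P] by blast
    qed
    have "row_len (lam - ?M) a = (if cond then row_len lam a - 1 else row_len lam a)"
      by (rule row_len_eqI) (use gone mem_iff_row[OF P] in auto)
    then show ?thesis using pos unfolding cond_def[symmetric] by (simp add: bead_def of_nat_diff)
  qed
  then have "beads (lam - ?M) = ?g ` beads lam"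
    unfolding beads_def image_image by (intro image_cong) auto
  also have "\<dots> = push_down (int l) i (beads lam)"
    using push_down_eq_image[of "int l" i "beads lam"] l by simp
  finally show ?thesis .
qed

lemma JM_add_addables:
  "2 \<le> l \<Longrightarrow> JM_partition l lam \<Longrightarrow> JM_partition l (lam \<union> addable l i lam)"
  using partition_add_addables[of l lam "addable l i lam" i] JM_push_up[of "int l" "beads lam" i]
  unfolding JM_partition_iff_beads by (simp add: beads_add_addables)

lemma JM_remove_removables:
  "2 \<le> l \<Longrightarrow> JM_partition l lam \<Longrightarrow> JM_partition l (lam - removable l i lam)"
  using partition_remove_removables[of l lam "removable l i lam" i] JM_push_down[of "int l" "beads lam" i]
  unfolding JM_partition_iff_beads by (simp add: beads_remove_removables)

section \<open>Addable boxes precede removable boxes in the reading order\<close>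

lemma strict_mono_mod_growth:
  fixes g :: "nat \<Rightarrow> int"
  assumes "m \<le> n" "\<And>j. m \<le> j \<Longrightarrow> j < n \<Longrightarrow> g j < g (Suc j) \<and> g (Suc j) mod l = g j mod l"
  shows "g m + l * int (n - m) \<le> g n"
  using assms
proof (induction n rule: dec_induct)
  case (step n)
  have "g n < g (Suc n)" "l dvd g (Suc n) - g n"
    using step.prems[of n] step.hyps by (auto simp: mod_eq_dvd_iff)
  then have "l \<le> g (Suc n) - g n" by (auto dest: zdvd_imp_le)
  moreover have "g m + l * int (n - m) \<le> g n" using step by simp
  ultimately show ?case using step.hyps by (simp add: Suc_diff_le algebra_simps)
qed simp

text \<open>Write the distance of \<open>p\<close> and \<open>q\<close> as \<open>l * k\<close>. If
  \<open>q < p\<close>, the gaps in between are at least \<open>l\<close> apart, so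
  \<open>b - d \<le> k\<close> and \<open>c - a = l * k - (b - d)\<close> is at least
  \<open>(l - 1) * (b - d)\<close>: the ladder of \<open>x\<close> is not to the right of that of
  \<open>y\<close>, and a tie is decided by \<open>a < c\<close>. If \<open>p < q\<close>, the beads
  in between are at least \<open>l\<close> apart, so \<open>a - c \<le> k\<close>, and
  \<open>d - b = l * k - (a - c)\<close> is large enough to put \<open>x\<close> on a strictly
  earlier ladder.\<close>

lemma addable_before_removable:
  assumes l: "3 \<le> l" and JM: "JM_partition l lam"
    and x: "x \<in> addable l i lam" and y: "y \<in> removable l i lam"
  shows "reading_key l x < reading_key l y"
proof -
  have P: "is_partition lam" and J: "JM_beads (int l) (beads lam)"
    using JM unfolding JM_partition_iff_beads by auto
  obtain a b c d where xy: "x = (a, b)" "y = (c, d)" by (cases x, cases y)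
  have pos: "1 \<le> a" "1 \<le> b" "1 \<le> c" "1 \<le> d"
    using x y partition_pos[OF P, of c d] unfolding xy addable_iff[OF P] removable_iff[OF P] by auto
  define p q where "p = int b - int a - 1" and "q = int d - int c - 1"
  have lens: "row_len lam a = b - 1" "col_len lam b = a - 1" "row_len lam c = d" "col_len lam d = c"
    using x y pos unfolding xy by (auto simp: addable_iff_len[OF P] removable_iff_len[OF P])
  have vals: "bead lam a = p" "gap lam b = p + 1" "bead lam c = q + 1" "gap lam d = q"
    using pos unfolding bead_def gap_def lens p_def q_def by (auto simp: of_nat_diff)
  have B: "p \<in> beads lam" "p + 1 \<notin> beads lam" "q + 1 \<in> beads lam" "q \<notin> beads lam"
    using vals bead_in_beads gap_notin_beads[OF P] pos by metis+
  have "(p + 1) mod int l = (q + 1) mod int l"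
    using x y by (simp add: xy addable_def removable_def residue_def p_def q_def)
  then have cong: "p mod int l = q mod int l" by (simp add: mod_succ_cong)
  have neq: "(z + 1) mod int l \<noteq> z mod int l" for z
    using mod_succ_neq[of "int l" z] l by simp
  have "p \<noteq> q" using B by auto
  then consider "q < p" | "p < q" by linarith
  then show ?thesis
  proof cases
    case 1
    \<comment> \<open>The condition for the bead \<open>p\<close> and the gap \<open>q\<close>: the
      bead \<open>q + 1\<close> above \<open>q\<close> has the wrong class, so the alternative on
      gaps must hold.\<close>
    have gaps: "\<forall>z. z \<notin> beads lam \<longrightarrow> z < p \<longrightarrow> z mod int l = p mod int l"
    proof -
      have "q < q + 1" by simp
      then show ?thesis using JM_beadsD[OF J B(1,4) 1 cong] B(3) neq by blast
    qed
    have "p \<noteq> q + 1" using cong neq[of q] by auto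
    then have ac: "a < c" using bead_less_iff[OF P pos(1) pos(3)] vals 1 by linarith
    have db: "d < b" using gap_less_iff[OF P pos(4) pos(2)] vals 1 by linarith
    have in_gap: "gap lam j \<notin> beads lam" "gap lam j < p" if "d \<le> j" "j < b" for j
    proof -
      show "gap lam j \<notin> beads lam" using gap_notin_beads[OF P] that pos by simp
      moreover have "gap lam j < p + 1" using gap_less_iff[OF P _ pos(2), of j] vals that pos by simp
      ultimately show "gap lam j < p" using B(1) by (cases "gap lam j = p") auto
    qed
    \<comment> \<open>Columns \<open>d\<close> to \<open>b - 1\<close> have gaps from
      \<open>q\<close> up to below \<open>p\<close>, all in one class, so each step gains at least
      \<open>l\<close>. Column \<open>b\<close> is left out because its gap \<open>p + 1\<close> has
      another class.\<close>
    have "gap lam d + int l * int (b - 1 - d) \<le> gap lam (b - 1)"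
    proof (rule strict_mono_mod_growth)
      show "d \<le> b - 1" using db by simp
      fix j assume j: "d \<le> j" "j < b - 1"
      then have "gap lam j < gap lam (Suc j)" using gap_strict_increasing[OF P] pos by simp
      moreover have "gap lam (Suc j) mod int l = gap lam j mod int l"
        using gaps in_gap[of j] in_gap[of "Suc j"] j by simp
      ultimately show "gap lam j < gap lam (Suc j) \<and> gap lam (Suc j) mod int l = gap lam j mod int l" ..
    qed
    also have "gap lam (b - 1) < p" using in_gap[of "b - 1"] db by simp
    finally have less: "int l * int (b - 1 - d) < p - q" using vals by simp
    obtain k where k: "p - q = int l * k" using cong by (metis mod_eq_dvd_iff dvdE)
    have "int (b - 1 - d) < k" using less l unfolding k by simp
    then have bk: "int b - int d \<le> k" using db by linarith
    have diff: "int c - int a = int l * k - (int b - int d)"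
      using k unfolding p_def q_def by linarith
    have "(int l - 1) * (int b - int d) \<le> int c - int a"
      using mult_left_mono[OF bk, of "int l"] diff by (simp add: algebra_simps)
    then have "ladder_value l x \<le> ladder_value l y"
      unfolding ladder_value_def xy by (simp add: algebra_simps)
    then show ?thesis using ac unfolding reading_key_def xy by auto
  next
    case 2
    \<comment> \<open>The condition for the bead \<open>q + 1\<close> and the gap
      \<open>p + 1\<close>: here the gap \<open>q\<close> refutes the alternative on gaps.\<close>
    have bds: "\<forall>z. z \<in> beads lam \<longrightarrow> p + 1 < z \<longrightarrow> z mod int l = (p + 1) mod int l"
    proof -
      have "(q + 1) mod int l = (p + 1) mod int l" using cong by (simp add: mod_succ_cong)
      moreover have "q mod int l \<noteq> (q + 1) mod int l" using neq[of q] by simp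
      ultimately show ?thesis using JM_beadsD[OF J B(3,2)] B(4) 2 by force
    qed
    have ca: "c < a" using bead_less_iff[OF P pos(3) pos(1)] vals 2 by linarith
    have in_bead: "bead lam j \<in> beads lam" "p + 1 < bead lam j" if "c \<le> j" "j < a" for j
    proof -
      show "bead lam j \<in> beads lam" using bead_in_beads that pos by simp
      moreover have "p < bead lam j" using bead_less_iff[OF P _ pos(1), of j] vals that pos by simp
      ultimately show "p + 1 < bead lam j" using B(2) by (cases "bead lam j = p + 1") auto
    qed
    \<comment> \<open>Beads decrease with the row, so they are negated to fit the growth estimate
      for increasing sequences.\<close>
    have "- bead lam c + int l * int (a - 1 - c) \<le> - bead lam (a - 1)"
    proof (rule strict_mono_mod_growth)
      show "c \<le> a - 1" using ca by simp
      fix j assume j: "c \<le> j" "j < a - 1"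
      then have "bead lam (Suc j) < bead lam j" using bead_strict_decreasing[OF P] pos by simp
      moreover have "bead lam (Suc j) mod int l = bead lam j mod int l"
        using bds in_bead[of j] in_bead[of "Suc j"] j by simp
      ultimately show "- bead lam j < - bead lam (Suc j) \<and> (- bead lam (Suc j)) mod int l = (- bead lam j) mod int l"
        using mod_minus_cong by auto
    qed
    moreover have "p + 1 < bead lam (a - 1)" using in_bead[of "a - 1"] ca by simp
    ultimately have less: "int l * int (a - 1 - c) < q - p" using vals by simp
    obtain k where k: "q - p = int l * k" using cong by (metis mod_eq_dvd_iff dvdE)
    have "int (a - 1 - c) < k" using less l unfolding k by simp
    then have ak: "int a - int c \<le> k" using ca by linarith
    then have k1: "1 \<le> k" using ca by linarith
    have diff: "int d - int b = int l * k - (int a - int c)"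
      using k unfolding p_def q_def by linarith
    \<comment> \<open>Here \<open>3 \<le> l\<close> matters: both \<open>l - 1 \<ge> 2\<close> and
      \<open>d - b \<ge> (l - 1) * k \<ge> 2 * k\<close> use it. The product is at least
      \<open>4 * k\<close>, hence strictly above \<open>a - c\<close>; equality would not do, since
      the row comparison \<open>c < a\<close> goes the wrong way.\<close>
    have "2 * (2 * k) \<le> (int l - 1) * (int d - int b)"
    proof (rule mult_mono)
      have "3 * k \<le> int l * k" using l k1 by (intro mult_right_mono) auto
      then show "2 * k \<le> int d - int b" using diff ak by linarith
    qed (use l k1 in auto)
    then have "int a - int c < (int l - 1) * (int d - int b)" using ak k1 by linarith
    then have "ladder_value l x < ladder_value l y"
      unfolding ladder_value_def xy by (simp add: algebra_simps)
    then show ?thesis unfolding reading_key_def by auto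
  qed
qed

section \<open>Signatures without cancellation and iterated crystal operators\<close>

lemma reduce_Plus_Minus:
  "reduce (map (Pair Plus) ps @ map (Pair Minus) ms) = map (Pair Plus) ps @ map (Pair Minus) ms"
proof (induction ps)
  case Nil
  show ?case
  proof (induction ms)
    case (Cons m ms)
    then show ?case by (cases ms) auto
  qed simp
qed simp

text \<open>With all addable boxes read first, no minus stands before a plus and the signature is
  already reduced. The split of the list is a hypothesis so that the lemma applies at every stage of
  the iterations.\<close>

lemma remaining_split:
  assumes list: "sorted_key_list_of_set (reading_key l) (addable l i lam \<union> removable l i lam) = ps @ ms"
    and ps: "set ps = addable l i lam" and ms: "set ms = removable l i lam"
  shows "remaining Plus l i lam = ps" "remaining Minus l i lam = ms"
proof -
  have plus: "map (\<lambda>x. (if x \<in> addable l i lam then Plus else Minus, x)) ps = map (Pair Plus) ps"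
    using ps by auto
  have minus: "map (\<lambda>x. (if x \<in> addable l i lam then Plus else Minus, x)) ms = map (Pair Minus) ms"
    using ms removable_not_addable[of _ l i lam] by auto
  have "reduced_ladder_signature l i lam = map (Pair Plus) ps @ map (Pair Minus) ms"
    unfolding reduced_ladder_signature_def reduced_word_eq_reduce ladder_signature_def list
      map_append plus minus
    by (rule reduce_Plus_Minus)
  then show "remaining Plus l i lam = ps" "remaining Minus l i lam = ms"
    by (simp_all add: remaining_def filter_map o_def)
qed

lemma sorted_wrt_split:
  assumes "sorted_wrt R xs" "\<And>x y. x \<in> set xs \<Longrightarrow> y \<in> set xs \<Longrightarrow> Q x \<Longrightarrow> \<not> Q y \<Longrightarrow> \<not> R y x"
  shows "xs = filter Q xs @ filter (\<lambda>x. \<not> Q x) xs"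
  using assms
proof (induction xs)
  case (Cons a xs)
  then have IH: "xs = filter Q xs @ filter (\<lambda>x. \<not> Q x) xs" by simp
  show ?case
  proof (cases "Q a")
    case False
    then have "\<forall>x\<in>set xs. \<not> Q x" using Cons.prems by auto
    then have "filter Q xs = []" "filter (\<lambda>x. \<not> Q x) xs = xs" by (auto simp: filter_empty_conv)
    with False show ?thesis by simp
  qed (use IH in simp)
qed simp

text \<open>Adding the box of the last plus turns it into a removable box. The union of addable and
  removable \<open>i\<close>-boxes, and with it the reading list, never changes; only the border
  between the plus part and the minus part moves one place to the left.\<close>

lemma iterate_f_hat:
  assumes l: "2 \<le> l" and P: "is_partition lam"
    and list: "sorted_key_list_of_set (reading_key l) (addable l i lam \<union> removable l i lam) = ps @ ms"
    and dist: "distinct (ps @ ms)"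
    and ps: "set ps = addable l i lam" and ms: "set ms = removable l i lam"
    and n: "n \<le> length ps"
  shows "iterate (f_hat l i) n lam = Some (lam \<union> set (drop (length ps - n) ps))"
  using n
proof (induction n)
  case (Suc n)
  define k where "k = length ps - Suc n"
  have k: "length ps - n = Suc k" "k < length ps" using Suc.prems unfolding k_def by auto
  define S where "S = set (drop (Suc k) ps)"
  have S: "S \<subseteq> addable l i lam" unfolding S_def ps[symmetric] by (rule set_drop_subset)
  have parts: "set (take (Suc k) ps) \<union> S = set ps" "set (take (Suc k) ps) \<inter> S = {}"
    using dist set_take_disj_set_drop_if_distinct[of ps "Suc k" "Suc k"]
    unfolding S_def by (simp_all flip: set_append)
  have A: "addable l i (lam \<union> S) = set (take (Suc k) ps)"
    unfolding addable_add_addables[OF l P S] ps[symmetric] parts(1)[symmetric] using parts(2) by blast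
  have M: "removable l i (lam \<union> S) = set (drop (Suc k) ps @ ms)"
    unfolding removable_add_addables[OF l P S] using ms S_def by auto
  have "addable l i (lam \<union> S) \<union> removable l i (lam \<union> S) = addable l i lam \<union> removable l i lam"
    unfolding addable_add_addables[OF l P S] removable_add_addables[OF l P S] using S by auto
  then have "remaining Plus l i (lam \<union> S) = take (Suc k) ps"
    by (intro remaining_split(1)[where ms = "drop (Suc k) ps @ ms"]) (simp_all add: list A M)
  then have "f_hat l i (lam \<union> S) = Some (insert (ps ! k) (lam \<union> S))"
    using k by (auto simp: f_hat_def take_Suc_conv_app_nth)
  moreover have "drop k ps = ps ! k # drop (Suc k) ps" using k by (simp add: Cons_nth_drop_Suc)
  ultimately show ?case
    using Suc k by (simp add: S_def k_def[symmetric])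
qed simp

text \<open>The same reading list is kept, and the border moves to the right: removing the box of
  the first minus makes it the last plus.\<close>

lemma iterate_e_hat:
  assumes l: "2 \<le> l" and P: "is_partition lam"
    and list: "sorted_key_list_of_set (reading_key l) (addable l i lam \<union> removable l i lam) = ps @ ms"
    and dist: "distinct (ps @ ms)"
    and ps: "set ps = addable l i lam" and ms: "set ms = removable l i lam"
    and n: "n \<le> length ms"
  shows "iterate (e_hat l i) n lam = Some (lam - set (take n ms))"
  using n
proof (induction n)
  case (Suc n)
  define S where "S = set (take n ms)"
  have S: "S \<subseteq> removable l i lam" unfolding S_def ms[symmetric] by (rule set_take_subset)
  have parts: "S \<union> set (drop n ms) = set ms" "S \<inter> set (drop n ms) = {}"
    using dist set_take_disj_set_drop_if_distinct[of ms n n]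
    unfolding S_def by (simp_all flip: set_append)
  have A: "addable l i (lam - S) = set (ps @ take n ms)"
    unfolding addable_remove_removables[OF l P S] using ps S_def by auto
  have M: "removable l i (lam - S) = set (drop n ms)"
    unfolding removable_remove_removables[OF l P S] ms[symmetric] parts(1)[symmetric] using parts(2) by blast
  have "addable l i (lam - S) \<union> removable l i (lam - S) = addable l i lam \<union> removable l i lam"
    unfolding addable_remove_removables[OF l P S] removable_remove_removables[OF l P S] using S by auto
  then have "remaining Minus l i (lam - S) = drop n ms"
    by (intro remaining_split(2)[where ps = "ps @ take n ms"]) (simp_all add: list A M)
  then have "e_hat l i (lam - S) = Some (lam - S - {ms ! n})"
    using Suc.prems by (auto simp: e_hat_def hd_drop_conv_nth)
  moreover have "take (Suc n) ms = take n ms @ [ms ! n]"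
    using Suc.prems by (simp add: take_Suc_conv_app_nth)
  ultimately show ?case
    using Suc by (simp add: S_def Diff_insert[symmetric])
qed simp

theorem theorem3p7p3p1:
  fixes l :: nat and i :: int and lam :: "box set"
  assumes "3 \<le> l"
    and "JM_partition l lam"
    and "0 \<le> i" and "i < int l"
  shows "(\<exists>\<mu>. iterate (f_hat l i) (phi_hat l i lam) lam = Some \<mu> \<and> JM_partition l \<mu>) \<and>
         (\<exists>\<mu>. iterate (e_hat l i) (eps_hat l i lam) lam = Some \<mu> \<and> JM_partition l \<mu>)"
proof -
  have l: "2 \<le> l" using assms(1) by simp
  have P: "is_partition lam" using assms(2) by (simp add: JM_partition_def)
  let ?A = "addable l i lam" and ?M = "removable l i lam"
  define L where "L = sorted_key_list_of_set (reading_key l) (?A \<union> ?M)"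
  have sorted: "sorted_wrt (<) (map (reading_key l) L)"
    unfolding L_def by (rule strict_sorted_key_list_of_set_inj[OF inj_reading_key[OF l]])
  then have dist: "distinct L"
    using strict_sorted_iff distinct_map by blast
  have set: "set L = ?A \<union> ?M"
    unfolding L_def
    by (rule set_sorted_key_list_of_set_inj[OF inj_reading_key[OF l] finite_addable_removable[OF P]])
  define ps ms where "ps = filter (\<lambda>x. x \<in> ?A) L" and "ms = filter (\<lambda>x. x \<notin> ?A) L"
  \<comment> \<open>Sorting by the reading key puts every addable box before every removable one, by
    \<open>addable_before_removable\<close>.\<close>
  have "L = ps @ ms"
    unfolding ps_def ms_def
  proof (rule sorted_wrt_split)
    show "sorted_wrt (\<lambda>x y. reading_key l x < reading_key l y) L"
      using sorted by (simp add: sorted_wrt_map)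
    show "\<not> reading_key l y < reading_key l x" if "x \<in> ?A" "y \<in> set L" "y \<notin> ?A" for x y
      using addable_before_removable[OF assms(1,2) that(1), of y] that(2,3) set by auto
  qed
  moreover have ps: "set ps = ?A" and ms: "set ms = ?M"
    using set removable_not_addable[of _ l i lam] unfolding ps_def ms_def by auto
  ultimately have split: "sorted_key_list_of_set (reading_key l) (?A \<union> ?M) = ps @ ms"
    "distinct (ps @ ms)" using dist L_def by auto
  note rem = remaining_split[OF split(1) ps ms]
  \<comment> \<open>As nothing cancels, \<open>phi_hat\<close> counts all addable
    \<open>i\<close>-boxes, so the iteration runs through the whole of \<open>ps\<close>;
    \<open>eps_hat\<close> and \<open>ms\<close> behave likewise.\<close>
  have "iterate (f_hat l i) (phi_hat l i lam) lam = Some (lam \<union> ?A)"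
    using iterate_f_hat[OF l P split ps ms, of "length ps"] ps by (simp add: phi_hat_def rem)
  moreover have "iterate (e_hat l i) (eps_hat l i lam) lam = Some (lam - ?M)"
    using iterate_e_hat[OF l P split ps ms, of "length ms"] ms by (simp add: eps_hat_def rem)
  ultimately show ?thesis
    using JM_add_addables[OF l assms(2)] JM_remove_removables[OF l assms(2)] by blast
qed

end
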